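(* For every constant dimension $d\ge 2$, the intersection graph of any $n$ fat axis-aligned boxes in $\mathbb{R}^d$ (e.g., axis-aligned hypercubes) has a 2-hop spanner with $O(n\log^{d+1} n)$ edges.
   Context: The intersection graph of a family of sets has one vertex per set and an (unweighted) edge between two distinct sets iff they have nonempty intersection. For a simple graph $G=(V,E)$, a $t$-hop spanner is a spanning subgraph $G'=(V,E')$, $E'\subseteq E$, with $d_{G'}(x,y)\le t\cdot d_G(x,y)$ for all $x,y\in V$, where $d_G$ is the shortest-path (hop) distance. A family of objects in $\mathbb{R}^d$ is fat if for every axis-aligned hypercube $\gamma$ with side length $\ell$, there exist $O(1)$ points (i.e., at most some constant number $c$ of points, $c$ independent of $n$ and $\gamma$) hitting all objects of the family that intersect $\gamma$ and have diameter at least $\ell$; a set of points hits an object if the object contains at least one of the points. An axis-aligned box is a product of $d$ intervals. The constant in the $O(\cdot)$ bound may depend on $d$ and on the fatness constant. *)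

theory Defs
  imports "HOL-Analysis.Analysis" "HOL-Library.Landau_Symbols" "HOL-Library.Extended_Nat"
begin

text \<open>A simple graph is given by a vertex set \<open>V\<close> and a set \<open>E\<close> of two-element subsets of \<open>V\<close>,
  so that \<open>card E\<close> counts undirected edges.\<close>

definition walk :: "'a set \<Rightarrow> 'a set set \<Rightarrow> 'a list \<Rightarrow> bool" where
  "walk V E p \<longleftrightarrow> p \<noteq> [] \<and> set p \<subseteq> V \<and> successively (\<lambda>u v. {u, v} \<in> E) p"

text \<open>The infimum of the empty set is \<open>\<infinity>\<close> in \<open>enat\<close>, which is the distance between vertices in
  different components.\<close>

definition hop_dist :: "'a set \<Rightarrow> 'a set set \<Rightarrow> 'a \<Rightarrow> 'a \<Rightarrow> enat" where
  "hop_dist V E x y =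
     (INF p\<in>{p. walk V E p \<and> hd p = x \<and> last p = y}. enat (length p - 1))"

definition hop_spanner :: "nat \<Rightarrow> 'a set \<Rightarrow> 'a set set \<Rightarrow> 'a set set \<Rightarrow> bool" where
  "hop_spanner t V E E' \<longleftrightarrow>
     E' \<subseteq> E \<and> (\<forall>x\<in>V. \<forall>y\<in>V. hop_dist V E' x y \<le> enat t * hop_dist V E x y)"

text \<open>The vertices of the intersection graph of a family \<open>\<F>\<close> are the members of \<open>\<F>\<close>.\<close>

definition intersection_edges :: "'a set set \<Rightarrow> 'a set set set" where
  "intersection_edges \<F> = {{A, B} | A B. A \<in> \<F> \<and> B \<in> \<F> \<and> A \<noteq> B \<and> A \<inter> B \<noteq> {}}"

text \<open>The intervals may be open, closed or half-open, degenerate or unbounded.\<close>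

definition axis_box :: "(real ^ 'd) set \<Rightarrow> bool" where
  "axis_box B \<longleftrightarrow>
     (\<exists>I :: 'd \<Rightarrow> real set. (\<forall>i. is_interval (I i)) \<and> B = {x. \<forall>i. x $ i \<in> I i})"

definition axis_cube :: "real ^ 'd \<Rightarrow> real \<Rightarrow> (real ^ 'd) set" where
  "axis_cube a l = {x. \<forall>i. a $ i \<le> x $ i \<and> x $ i \<le> a $ i + l}"

text \<open>\<open>fat c \<F>\<close> is fatness with the constant \<open>c\<close> as the bound on the number of hitting points.
  The library sets the diameter of an unbounded set to \<open>0\<close>; here such a set has infinite diameter
  and hence counts as having diameter at least \<open>l\<close>.\<close>

definition fat :: "nat \<Rightarrow> (real ^ 'd) set set \<Rightarrow> bool" where
  "fat c \<F> \<longleftrightarrow>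
     (\<forall>a l. 0 < l \<longrightarrow>
       (\<exists>P. finite P \<and> card P \<le> c \<and>
         (\<forall>B\<in>\<F>. B \<inter> axis_cube a l \<noteq> {} \<and> (\<not> bounded B \<or> l \<le> diameter B) \<longrightarrow> P \<inter> B \<noteq> {})))"

end

theory Submission
  imports Defs "HOL-Library.Product_Order" "HOL-Real_Asymp.Real_Asymp"
begin

text \<open>If all boxes of a set \<open>B\<close> contain a point \<open>p\<close>, then \<open>B\<close> is a clique, so a complete bipartite
  pattern between \<open>A\<close> and \<open>B\<close> is spanned by one star centred in \<open>B\<close>. On either side of \<open>p\<close> in a
  fixed coordinate, the projections of the boxes of \<open>B\<close> are nested, so the intersection pattern of
  \<open>A\<close> and \<open>B\<close> decomposes into such stars at the price of one logarithm per coordinate.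

  Fatness reduces the general case to this one. Assign a box to the dyadic cells of side
  comparable to its diameter that it meets. If \<open>a\<close> and \<open>b\<close> intersect and \<open>a\<close> is not larger than
  \<open>b\<close>, then some cell of \<open>a\<close> lies below some cell of \<open>b\<close> in the quadtree. A centroid decomposition
  of the quadtree finds a cell \<open>x\<close> between the two, with total group size \<open>O(n log n)\<close>, and the
  boxes \<open>b\<close> that meet \<open>x\<close> and are assigned to larger cells are hit by \<open>c\<close> points. Unbounded boxes
  form one further such group, for a cube that meets every box.\<close>

section \<open>Spanned sets of pairs\<close>

text \<open>An edge budget for a set of demanded pairs, so that the budgets of pieces of the pattern
  simply add up. Pairs are ordered because the two sides of a pattern play different roles later.
  Finiteness of \<open>E'\<close> is required because \<open>card\<close> of an infinite set is
  \<open>0\<close>.\<close>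

definition spanned :: "'a set set \<Rightarrow> nat \<Rightarrow> ('a \<times> 'a) set \<Rightarrow> bool" where
  "spanned E n T \<longleftrightarrow>
     (\<exists>E'\<subseteq>E. finite E' \<and> card E' \<le> n \<and>
        (\<forall>(a, b)\<in>T. {a, b} \<in> E' \<or> (\<exists>z. {a, z} \<in> E' \<and> {z, b} \<in> E')))"

lemma spanned_mono: "spanned E n T \<Longrightarrow> n \<le> m \<Longrightarrow> T' \<subseteq> T \<Longrightarrow> spanned E m T'"
  unfolding spanned_def by (meson in_mono order_trans)

lemma spanned_empty: "spanned E n {}"
  unfolding spanned_def by (intro exI[of _ "{}"]) auto

lemma spanned_Un:
  assumes "spanned E n S" "spanned E m T"
  shows "spanned E (n + m) (S \<union> T)"
proof -
  obtain E1 where E1: "E1 \<subseteq> E" "finite E1" "card E1 \<le> n"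
    "\<And>a b. (a, b) \<in> S \<Longrightarrow> {a, b} \<in> E1 \<or> (\<exists>z. {a, z} \<in> E1 \<and> {z, b} \<in> E1)"
    using assms(1) unfolding spanned_def by blast
  obtain E2 where E2: "E2 \<subseteq> E" "finite E2" "card E2 \<le> m"
    "\<And>a b. (a, b) \<in> T \<Longrightarrow> {a, b} \<in> E2 \<or> (\<exists>z. {a, z} \<in> E2 \<and> {z, b} \<in> E2)"
    using assms(2) unfolding spanned_def by blast
  have "card (E1 \<union> E2) \<le> n + m"
    using card_Un_le[of E1 E2] E1(3) E2(3) by linarith
  moreover have "{a, b} \<in> E1 \<union> E2 \<or> (\<exists>z. {a, z} \<in> E1 \<union> E2 \<and> {z, b} \<in> E1 \<union> E2)"
    if "(a, b) \<in> S \<union> T" for a b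
    using that E1(4) E2(4) by blast
  ultimately show ?thesis
    unfolding spanned_def using E1(1,2) E2(1,2) by (intro exI[of _ "E1 \<union> E2"]) auto
qed

lemma spanned_UN:
  assumes "finite I" "\<And>i. i \<in> I \<Longrightarrow> spanned E (n i) (T i)"
  shows "spanned E (\<Sum>i\<in>I. n i) (\<Union>i\<in>I. T i)"
  using assms
proof (induction I rule: finite_induct)
  case empty
  then show ?case by (simp add: spanned_empty)
next
  case (insert i I)
  then have "spanned E (n i + (\<Sum>i\<in>I. n i)) (T i \<union> (\<Union>i\<in>I. T i))"
    by (intro spanned_Un) simp_all
  then show ?case using insert.hyps by simp
qed

text \<open>Joining every other vertex to \<open>z\<close> links any two of them through
  \<open>z\<close>. The absence of singletons in \<open>E\<close> excludes the pair
  \<open>(z, z)\<close>, which such a star may miss.\<close>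

lemma spanned_star:
  assumes "finite A" "finite B" "z \<in> B" "\<And>x. x \<in> A \<union> B \<Longrightarrow> x \<noteq> z \<Longrightarrow> {x, z} \<in> E"
    "\<And>x. {x} \<notin> E"
  shows "spanned E (card A + card B) {(a, b) \<in> A \<times> B. {a, b} \<in> E}"
proof -
  define E' where "E' = (\<lambda>x. {x, z}) ` (A \<union> B - {z})"
  have "card E' \<le> card (A \<union> B - {z})"
    unfolding E'_def using assms(1,2) by (intro card_image_le) auto
  also have "\<dots> \<le> card (A \<union> B)"
    using assms(1,2) by (intro card_mono) auto
  also have "\<dots> \<le> card A + card B" by (rule card_Un_le)
  finally have "card E' \<le> card A + card B" .
  moreover have "{a, b} \<in> E' \<or> (\<exists>z. {a, z} \<in> E' \<and> {z, b} \<in> E')"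
    if "a \<in> A" "b \<in> B" "{a, b} \<in> E" for a b
  proof -
    have ne: "a \<noteq> b" using that assms(5) by auto
    have *: "{x, z} \<in> E'" "{z, x} \<in> E'" if "x \<in> A \<union> B" "x \<noteq> z" for x
      using that unfolding E'_def by (auto simp: insert_commute)
    show ?thesis using ne * that by (cases "a = z"; cases "b = z") blast+
  qed
  moreover have "E' \<subseteq> E" unfolding E'_def using assms(4) by blast
  moreover have "finite E'" unfolding E'_def using assms(1,2) by blast
  ultimately show ?thesis
    unfolding spanned_def by (intro exI[of _ E']) auto
qed

text \<open>\<open>B1\<close> grows by an index whose set is minimal among the remaining ones; in a
  chain, minimal means least. Splitting indices rather than sets allows any cardinality, even if
  many indices share one set.\<close>

lemma nested_split:
  fixes N :: "'b \<Rightarrow> 'a set"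
  assumes "finite B" "\<And>b b'. b \<in> B \<Longrightarrow> b' \<in> B \<Longrightarrow> N b \<subseteq> N b' \<or> N b' \<subseteq> N b" "m \<le> card B"
  shows "\<exists>B1\<subseteq>B. card B1 = m \<and> (\<forall>b1\<in>B1. \<forall>b2\<in>B - B1. N b1 \<subseteq> N b2)"
  using assms(3)
proof (induction m)
  case 0
  then show ?case by (intro exI[of _ "{}"]) auto
next
  case (Suc m)
  then obtain B1 where B1: "B1 \<subseteq> B" "card B1 = m" "\<And>b1 b2. b1 \<in> B1 \<Longrightarrow> b2 \<in> B - B1 \<Longrightarrow> N b1 \<subseteq> N b2"
    by auto
  have "finite (N ` (B - B1))" "N ` (B - B1) \<noteq> {}"
    using assms(1) B1 Suc.prems by (auto dest!: card_mono[OF finite_subset[OF B1(1) assms(1)]])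
  then have "\<exists>m\<in>N ` (B - B1). \<forall>x\<in>N ` (B - B1). x \<subseteq> m \<longrightarrow> m = x"
    by (rule finite_has_minimal)
  then obtain b where b: "b \<in> B - B1" "\<And>b'. b' \<in> B - B1 \<Longrightarrow> N b' \<subseteq> N b \<Longrightarrow> N b' = N b"
    by (metis (no_types, lifting) image_iff imageI)
  have "N b \<subseteq> N b'" if "b' \<in> B - B1" for b'
    using assms(2)[of b b'] b that by blast
  then show ?case
    using B1 b(1) finite_subset[OF B1(1) assms(1)]
    by (intro exI[of _ "insert b B1"]) auto
qed

text \<open>Divide and conquer on the chain of neighbourhoods. \<open>B\<close> is halved into a
  lower part \<open>B1\<close> and an upper part \<open>B2\<close>, and \<open>X\<close> consists of
  the elements related to all of \<open>B2\<close>. The pattern between \<open>X\<close> and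
  \<open>B2\<close> is complete; what remains lies between \<open>X\<close> and \<open>B1\<close> or
  between \<open>A - X\<close> and \<open>B2\<close>. Both sides are thereby partitioned, so each of
  the \<open>k + 1\<close> levels of the recursion costs at most
  \<open>C * (card A + card B)\<close>.\<close>

lemma spanned_nested:
  assumes "finite A" "finite B" "card B \<le> 2 ^ k"
    and "\<And>b b'. b \<in> B \<Longrightarrow> b' \<in> B \<Longrightarrow> {a\<in>A. R a b} \<subseteq> {a\<in>A. R a b'} \<or> {a\<in>A. R a b'} \<subseteq> {a\<in>A. R a b}"
    and "\<And>A' B'. A' \<subseteq> A \<Longrightarrow> B' \<subseteq> B \<Longrightarrow> (\<And>a b. a \<in> A' \<Longrightarrow> b \<in> B' \<Longrightarrow> R a b) \<Longrightarrow>
      spanned E (C * (card A' + card B')) {(a, b) \<in> A' \<times> B'. {a, b} \<in> E}"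
  shows "spanned E (C * (k + 1) * (card A + card B)) {(a, b) \<in> A \<times> B. R a b \<and> {a, b} \<in> E}"
  using assms
proof (induction k arbitrary: A B)
  case 0
  \<comment> \<open>Here \<open>B\<close> has at most one element, so the related pairs already form
    a complete pattern.\<close>
  have "spanned E (C * (card {a\<in>A. \<forall>b\<in>B. R a b} + card B))
      {(a, b) \<in> {a\<in>A. \<forall>b\<in>B. R a b} \<times> B. {a, b} \<in> E}"
    by (intro 0) auto
  moreover have "b = b'" if "b \<in> B" "b' \<in> B" for b b'
    using 0(2,3) that card_le_Suc0_iff_eq by auto
  moreover have "card {a\<in>A. \<forall>b\<in>B. R a b} \<le> card A"
    using 0(1) by (intro card_mono) auto
  ultimately show ?case
    by (elim spanned_mono) auto
next
  case (Suc k)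
  define m where "m = card B div 2"
  obtain B1 where B1: "B1 \<subseteq> B" "card B1 = m"
    "\<And>b1 b2. b1 \<in> B1 \<Longrightarrow> b2 \<in> B - B1 \<Longrightarrow> {a\<in>A. R a b1} \<subseteq> {a\<in>A. R a b2}"
    using nested_split[of B "\<lambda>b. {a\<in>A. R a b}" m] Suc.prems(2,4) unfolding m_def by auto
  define B2 where "B2 = B - B1"
  define X where "X = {a\<in>A. \<forall>b\<in>B2. R a b}"
  have fin: "finite B1" "finite B2" "finite X"
    using Suc.prems(1,2) B1(1) finite_subset by (auto simp: B2_def X_def)
  have cB: "card B = card B1 + card B2"
    unfolding B2_def using card_Diff_subset[OF fin(1) B1(1)] card_mono[OF Suc.prems(2) B1(1)] by linarith
  have cA: "card A = card X + card (A - X)"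
    using card_Diff_subset[of X A] card_mono[of A X] fin(3) Suc.prems(1) by (auto simp: X_def)
  have "card B \<le> 2 * 2 ^ k" using Suc.prems(3) by simp
  then have le: "card B1 \<le> 2 ^ k" "card B2 \<le> 2 ^ k"
    using cB B1(2) unfolding m_def by linarith+
  have s0: "spanned E (C * (card X + card B2)) {(a, b) \<in> X \<times> B2. {a, b} \<in> E}"
    by (intro Suc.prems(5)) (auto simp: X_def B2_def)
  have s1: "spanned E (C * (k + 1) * (card X + card B1)) {(a, b) \<in> X \<times> B1. R a b \<and> {a, b} \<in> E}"
  proof (rule Suc.IH[OF fin(3) fin(1) le(1)])
    fix b b' assume "b \<in> B1" "b' \<in> B1"
    then have "{a\<in>A. R a b} \<subseteq> {a\<in>A. R a b'} \<or> {a\<in>A. R a b'} \<subseteq> {a\<in>A. R a b}"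
      using Suc.prems(4) B1(1) by auto
    then show "{a\<in>X. R a b} \<subseteq> {a\<in>X. R a b'} \<or> {a\<in>X. R a b'} \<subseteq> {a\<in>X. R a b}"
      unfolding X_def by blast
  next
    fix A' B' assume "A' \<subseteq> X" "B' \<subseteq> B1" "\<And>a b. a \<in> A' \<Longrightarrow> b \<in> B' \<Longrightarrow> R a b"
    then show "spanned E (C * (card A' + card B')) {(a, b) \<in> A' \<times> B'. {a, b} \<in> E}"
      using B1(1) by (intro Suc.prems(5)) (auto simp: X_def)
  qed
  have s2: "spanned E (C * (k + 1) * (card (A - X) + card B2)) {(a, b) \<in> (A - X) \<times> B2. R a b \<and> {a, b} \<in> E}"
  proof (rule Suc.IH[OF _ fin(2) le(2)])
    show "finite (A - X)" using Suc.prems(1) by auto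
  next
    fix b b' assume "b \<in> B2" "b' \<in> B2"
    then have "{a\<in>A. R a b} \<subseteq> {a\<in>A. R a b'} \<or> {a\<in>A. R a b'} \<subseteq> {a\<in>A. R a b}"
      using Suc.prems(4) by (auto simp: B2_def)
    then show "{a\<in>A-X. R a b} \<subseteq> {a\<in>A-X. R a b'} \<or> {a\<in>A-X. R a b'} \<subseteq> {a\<in>A-X. R a b}"
      by blast
  next
    fix A' B' assume "A' \<subseteq> A - X" "B' \<subseteq> B2" "\<And>a b. a \<in> A' \<Longrightarrow> b \<in> B' \<Longrightarrow> R a b"
    then show "spanned E (C * (card A' + card B')) {(a, b) \<in> A' \<times> B'. {a, b} \<in> E}"
      by (intro Suc.prems(5)) (auto simp: B2_def)
  qed
  \<comment> \<open>No pair joins \<open>A - X\<close> to \<open>B1\<close>: a neighbour of an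
    element of \<open>B1\<close> is a neighbour of every element of \<open>B2\<close> and hence lies
    in \<open>X\<close>.\<close>
  have "{(a, b) \<in> A \<times> B. R a b \<and> {a, b} \<in> E} \<subseteq>
    {(a, b) \<in> X \<times> B2. {a, b} \<in> E} \<union> {(a, b) \<in> X \<times> B1. R a b \<and> {a, b} \<in> E} \<union>
    {(a, b) \<in> (A - X) \<times> B2. R a b \<and> {a, b} \<in> E}"
    using B1(3) unfolding X_def B2_def by blast
  moreover have "C * (card X + card B2) + C * (k + 1) * (card X + card B1) +
      C * (k + 1) * (card (A - X) + card B2) \<le> C * (Suc k + 1) * (card A + card B)"
    unfolding cA cB by (simp add: algebra_simps)
  ultimately show ?case
    using spanned_mono[OF spanned_Un[OF spanned_Un[OF s0 s1] s2]] by blast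
qed

section \<open>Boxes stabbed by a common point\<close>

text \<open>The witness is \<open>x\<close> with its coordinate \<open>i\<close> replaced by
  \<open>t\<close>, which a product of intervals permits.\<close>

lemma axis_box_convexD:
  fixes b :: "(real ^ 'd) set"
  assumes "axis_box b" "x \<in> b" "y \<in> b" "x $ i \<le> t" "t \<le> y $ i"
  shows "\<exists>z\<in>b. z $ i = t"
proof -
  obtain I where I: "\<And>i. is_interval (I i)" "b = {x. \<forall>i. x $ i \<in> I i}"
    using assms(1) unfolding axis_box_def by blast
  have "t \<in> I i"
    using I assms is_interval_1[of "I i"] by blast
  then show ?thesis
    using assms(2) I(2) by (intro bexI[of _ "\<chi> j. if j = i then t else x $ j"]) auto
qed

text \<open>Boxes are products, so common values found separately in each coordinate assemble to one
  common point.\<close>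

lemma axis_box_Int_nonempty:
  fixes a b :: "(real ^ 'd) set"
  assumes "axis_box a" "axis_box b" "\<And>i. \<exists>x\<in>a. \<exists>y\<in>b. x $ i = y $ i"
  shows "a \<inter> b \<noteq> {}"
proof -
  obtain I where I: "a = {x. \<forall>i. x $ i \<in> I i}" using assms(1) unfolding axis_box_def by blast
  obtain J where J: "b = {x. \<forall>i. x $ i \<in> J i}" using assms(2) unfolding axis_box_def by blast
  have "\<forall>i. \<exists>t. t \<in> I i \<inter> J i" using assms(3) unfolding I J by (metis IntI mem_Collect_eq)
  then obtain t where "\<And>i. t i \<in> I i \<inter> J i" by metis
  then have "(\<chi> i. t i) \<in> a \<inter> b" unfolding I J by auto
  then show ?thesis by blast
qed

lemma singleton_not_intersection_edge: "{x} \<notin> intersection_edges \<F>"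
  unfolding intersection_edges_def by (auto simp: singleton_insert_inj_eq doubleton_eq_iff)

lemma intersection_edges_iff:
  "{a, b} \<in> intersection_edges \<F> \<longleftrightarrow> a \<in> \<F> \<and> b \<in> \<F> \<and> a \<noteq> b \<and> a \<inter> b \<noteq> {}"
  unfolding intersection_edges_def by (auto simp: doubleton_eq_iff)

text \<open>Induction on the set \<open>J\<close> of coordinates in which the projections of
  \<open>a\<close> and \<open>b\<close> are not yet known to meet. For empty \<open>J\<close> all
  pairs intersect, and any member of \<open>B\<close> is the centre of a star. Each further
  coordinate needs two nested patterns, one for each side of \<open>p\<close>, and so multiplies the
  cost by \<open>2 * (k + 1)\<close>.\<close>

lemma spanned_stabbed:
  fixes \<F> :: "(real ^ 'd) set set"
  assumes "finite J" "finite \<F>" "\<And>b. b \<in> \<F> \<Longrightarrow> axis_box b"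
    and "A \<subseteq> \<F>" "B \<subseteq> \<F>" "card B \<le> 2 ^ k" "\<And>b. b \<in> B \<Longrightarrow> p \<in> b"
    and "\<And>a b i. a \<in> A \<Longrightarrow> b \<in> B \<Longrightarrow> i \<notin> J \<Longrightarrow> \<exists>x\<in>a. \<exists>y\<in>b. x $ i = y $ i"
  shows "spanned (intersection_edges \<F>) ((2 * (k + 1)) ^ card J * (card A + card B))
    {(a, b) \<in> A \<times> B. {a, b} \<in> intersection_edges \<F>}"
  using assms(1,4-)
proof (induction J arbitrary: A B rule: finite_induct)
  case empty
  show ?case
  proof (cases "B = {}")
    case False
    then obtain z where z: "z \<in> B" by blast
    have fin: "finite A" "finite B"
      using empty assms(2) finite_subset by blast+
    have "{x, z} \<in> intersection_edges \<F>" if "x \<in> A \<union> B" "x \<noteq> z" for x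
    proof -
      have "x \<inter> z \<noteq> {}"
      proof (cases "x \<in> B")
        case True
        then show ?thesis using empty.prems(4) z by blast
      next
        case False
        then have "x \<in> A" using that by blast
        then show ?thesis
          using axis_box_Int_nonempty[of x z] empty.prems(1,2,5) z assms(3) by blast
      qed
      then show ?thesis
        using that z empty.prems(1,2) unfolding intersection_edges_iff by blast
    qed
    then show ?thesis
      using spanned_star[OF fin z, of "intersection_edges \<F>"] singleton_not_intersection_edge by auto
  qed (auto intro: spanned_empty)
next
  case (insert j J)
  have fin: "finite A" "finite B"
    using insert.prems assms(2) finite_subset by blast+
  define C where "C = (2 * (k + 1)) ^ card J"
  have *: "spanned (intersection_edges \<F>) (C * (card A' + card B'))
      {(a, b) \<in> A' \<times> B'. {a, b} \<in> intersection_edges \<F>}"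
    if "A' \<subseteq> A" "B' \<subseteq> B" "\<And>a b. a \<in> A' \<Longrightarrow> b \<in> B' \<Longrightarrow> \<exists>x\<in>a. \<exists>y\<in>b. x $ j = y $ j" for A' B'
    unfolding C_def
  proof (rule insert.IH)
    show "card B' \<le> 2 ^ k"
      using card_mono[OF fin(2) that(2)] insert.prems(3) by linarith
    fix a b i assume ab: "a \<in> A'" "b \<in> B'" "i \<notin> J"
    show "\<exists>x\<in>a. \<exists>y\<in>b. x $ i = y $ i"
      using that(3)[OF ab(1,2)] insert.prems(5)[of a b i] ab that(1,2) by (cases "i = j") auto
  qed (use insert.prems that in auto)
  \<comment> \<open>The sign \<open>s\<close> selects the side of \<open>p\<close> on which \<open>a\<close> and \<open>b\<close> meet in coordinate \<open>j\<close>; there the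
    projections of the boxes of \<open>B\<close> start at \<open>p\<close> and hence are nested.\<close>
  define R where "R = (\<lambda>s a b. \<exists>x\<in>a. \<exists>y\<in>b. x $ j = y $ j \<and> s * p $ j \<le> s * x $ j)"
  have nested: "{a\<in>A. R s a b} \<subseteq> {a\<in>A. R s a b'} \<or> {a\<in>A. R s a b'} \<subseteq> {a\<in>A. R s a b}"
    if b: "b \<in> B" "b' \<in> B" and s: "s = 1 \<or> s = -1" for s b b'
  proof (rule ccontr)
    assume "\<not> ?thesis"
    then obtain a a' where a: "R s a b" "\<not> R s a b'" "R s a' b'" "\<not> R s a' b"
      by blast
    obtain x y where x: "x \<in> a" "y \<in> b" "x $ j = y $ j" "s * p $ j \<le> s * x $ j"
      using a(1) unfolding R_def by blast
    obtain x' y' where x': "x' \<in> a'" "y' \<in> b'" "x' $ j = y' $ j" "s * p $ j \<le> s * x' $ j"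
      using a(3) unfolding R_def by blast
    have pb: "p \<in> b" "p \<in> b'" "axis_box b" "axis_box b'"
      using b insert.prems(2,4) assms(3) by blast+
    \<comment> \<open>On the side given by \<open>s\<close>, the value \<open>x' $ j\<close> lies
      between those of \<open>p\<close> and \<open>y\<close>, both points of \<open>b\<close>. So
      \<open>b\<close> reaches this value as well, and \<open>a'\<close> meets \<open>b\<close>
      there. The two uses of convexity serve the two signs; the next fact is symmetric.\<close>
    have 1: "\<exists>z\<in>b. z $ j = x' $ j" if "s * x' $ j \<le> s * x $ j"
      using axis_box_convexD[OF pb(3,1) x(2), of j "x' $ j"]
        axis_box_convexD[OF pb(3) x(2) pb(1), of j "x' $ j"] that s x(3) x'(4) by auto
    have 2: "\<exists>z\<in>b'. z $ j = x $ j" if "s * x $ j \<le> s * x' $ j"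
      using axis_box_convexD[OF pb(4,2) x'(2), of j "x $ j"]
        axis_box_convexD[OF pb(4) x'(2) pb(2), of j "x $ j"] that s x'(3) x(4) by auto
    have "s * x' $ j \<le> s * x $ j \<or> s * x $ j \<le> s * x' $ j" by linarith
    then show False
    proof
      assume "s * x' $ j \<le> s * x $ j"
      then show False using 1 a(4) x'(1,4) unfolding R_def by metis
    next
      assume "s * x $ j \<le> s * x' $ j"
      then show False using 2 a(2) x(1,4) unfolding R_def by metis
    qed
  qed
  have half: "spanned (intersection_edges \<F>) (C * (k + 1) * (card A + card B))
      {(a, b) \<in> A \<times> B. R s a b \<and> {a, b} \<in> intersection_edges \<F>}" if "s = 1 \<or> s = -1" for s
    using fin insert.prems(3) nested[OF _ _ that]
  proof (rule spanned_nested)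
    fix A' B' assume "A' \<subseteq> A" "B' \<subseteq> B" "\<And>a b. a \<in> A' \<Longrightarrow> b \<in> B' \<Longrightarrow> R s a b"
    then show "spanned (intersection_edges \<F>) (C * (card A' + card B'))
      {(a, b) \<in> A' \<times> B'. {a, b} \<in> intersection_edges \<F>}"
      unfolding R_def by (intro *) blast+
  qed auto
  have R: "R 1 a b \<or> R (-1) a b" if e: "{a, b} \<in> intersection_edges \<F>" for a b
  proof -
    obtain x where "x \<in> a" "x \<in> b" using e unfolding intersection_edges_iff by blast
    then show ?thesis unfolding R_def by (cases "p $ j \<le> x $ j") auto
  qed
  have "C * (k + 1) * (card A + card B) + C * (k + 1) * (card A + card B)
      \<le> (2 * (k + 1)) ^ card (insert j J) * (card A + card B)"
    using insert.hyps by (simp add: C_def algebra_simps)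
  then show ?case
    by (rule spanned_mono[OF spanned_Un[OF half[of 1] half[of "-1"]], rotated 2]) (use R in auto)
qed

section \<open>Centroid decomposition of forest orders\<close>

text \<open>Separating at the minimal elements whose down-sets have weight at least half of the bound
  on the weights of all principal down-sets halves that bound.\<close>
lemma forest_decomposition:
  fixes S :: "'a::order set" and w :: "'a \<Rightarrow> nat"
  assumes "finite S"
    and "\<And>q x y. q \<in> S \<Longrightarrow> x \<in> S \<Longrightarrow> y \<in> S \<Longrightarrow> q \<le> x \<Longrightarrow> q \<le> y \<Longrightarrow> x \<le> y \<or> y \<le> x"
    and "\<And>x. x \<in> S \<Longrightarrow> 0 < w x"
    and "\<And>x. x \<in> S \<Longrightarrow> sum w {q\<in>S. q \<le> x} < 2 ^ k"
  shows "\<exists>D U. (\<forall>x\<in>S. D x \<subseteq> {q\<in>S. q \<le> x} \<and> U x \<subseteq> {q\<in>S. x \<le> q}) \<and>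
    (\<forall>q\<in>S. \<forall>r\<in>S. q \<le> r \<longrightarrow> (\<exists>x\<in>S. q \<in> D x \<and> r \<in> U x)) \<and>
    (\<Sum>x\<in>S. sum w (D x) + sum w (U x)) \<le> 2 * k * sum w S"
  using assms
proof (induction k arbitrary: S)
  case 0
  \<comment> \<open>Weights are positive, so no element can have a down-set of weight below
    \<open>2 ^ 0\<close>.\<close>
  have "S = {}"
  proof (rule ccontr)
    assume "S \<noteq> {}"
    then obtain x where x: "x \<in> S" by blast
    have "w x \<le> sum w {q\<in>S. q \<le> x}"
      using 0(1) x by (intro member_le_sum) auto
    then show False using 0(3)[OF x] 0(4)[OF x] by simp
  qed
  then show ?case by simp
next
  case (Suc k)
  define dn where "dn = (\<lambda>x. {q\<in>S. q \<le> x})"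
  define up where "up = (\<lambda>x. {q\<in>S. x \<le> q})"
  have fin: "finite (dn x)" "finite (up x)" for x
    using Suc.prems(1) by (auto simp: dn_def up_def)
  define H where "H = {x\<in>S. 2 ^ k \<le> sum w (dn x)}"
  define M where "M = {x\<in>H. \<forall>y\<in>H. y \<le> x \<longrightarrow> y = x}"
  have MS: "M \<subseteq> S" unfolding M_def H_def by blast
  have finM: "finite M" using MS Suc.prems(1) finite_subset by blast
  \<comment> \<open>A common lower bound would make \<open>x\<close> and \<open>y\<close> comparable
    by the forest property, and then equal by minimality.\<close>
  have dn_disj: "dn x \<inter> dn y = {}" if "x \<in> M" "y \<in> M" "x \<noteq> y" for x y
    using that Suc.prems(2) unfolding M_def H_def dn_def by blast
  \<comment> \<open>A common upper bound would carry two disjoint down-sets of weight at least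
    \<open>2 ^ k\<close> each, which reaches the bound \<open>2 ^ Suc k\<close>.\<close>
  have up_disj: "up x \<inter> up y = {}" if "x \<in> M" "y \<in> M" "x \<noteq> y" for x y
  proof (rule ccontr)
    assume "up x \<inter> up y \<noteq> {}"
    then obtain r where r: "r \<in> S" "x \<le> r" "y \<le> r" unfolding up_def by blast
    have "2 ^ k + 2 ^ k \<le> sum w (dn x) + sum w (dn y)"
      using that unfolding M_def H_def by (intro add_mono) auto
    also have "\<dots> = sum w (dn x \<union> dn y)"
      using dn_disj[OF that] fin by (simp add: sum.union_disjoint)
    also have "\<dots> \<le> sum w (dn r)"
      using r fin by (intro sum_mono2) (auto simp: dn_def)
    finally show False using Suc.prems(4)[OF r(1)] unfolding dn_def by simp
  qed
  have M_below: "\<exists>m\<in>M. m \<le> x" if "x \<in> H" for x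
  proof -
    have "finite {y\<in>H. y \<le> x}" "{y\<in>H. y \<le> x} \<noteq> {}"
      using Suc.prems(1) that by (auto simp: H_def)
    from finite_has_minimal[OF this]
    obtain m where m: "m \<in> H" "m \<le> x" "\<forall>y\<in>{y\<in>H. y \<le> x}. y \<le> m \<longrightarrow> m = y"
      by blast
    have "y = m" if "y \<in> H" "y \<le> m" for y
      using that m order_trans[OF that(2) m(2)] by auto
    then have "m \<in> M" unfolding M_def using m(1) by blast
    then show ?thesis using m by blast
  qed
  \<comment> \<open>The recursion continues on \<open>S1\<close>, the elements below no member of
    \<open>M\<close>, and on \<open>S2\<close>, those strictly below some member.\<close>
  define L where "L = (\<Union>m\<in>M. dn m)"
  define S1 where "S1 = S - L"
  define S2 where "S2 = L - M"
  have M_L: "M \<subseteq> L" using MS unfolding L_def dn_def by auto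
  have LS: "L \<subseteq> S" unfolding L_def dn_def by auto
  have S1S: "S1 \<subseteq> S" and S2S: "S2 \<subseteq> S" using LS unfolding S1_def S2_def by auto
  have f1: "finite S1" and f2: "finite S2" using S1S S2S Suc.prems(1) finite_subset by auto
  have light: "sum w (dn x) < 2 ^ k" if "x \<in> S" "x \<notin> H" for x
    using that unfolding H_def by auto
  \<comment> \<open>If \<open>x\<close> is heavy, some \<open>m\<close> in \<open>M\<close> lies
    below it. Its down-set, of weight at least \<open>2 ^ k\<close>, has been removed from one of
    weight less than \<open>2 ^ Suc k\<close>.\<close>
  have b1: "sum w {q\<in>S1. q \<le> x} < 2 ^ k" if x: "x \<in> S1" for x
  proof (cases "x \<in> H")
    case False
    have "sum w {q\<in>S1. q \<le> x} \<le> sum w (dn x)"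
      using S1S fin by (intro sum_mono2) (auto simp: dn_def)
    then show ?thesis using light[of x] False x S1S by force
  next
    case True
    then obtain m where m: "m \<in> M" "m \<le> x" using M_below by blast
    have "sum w {q\<in>S1. q \<le> x} + sum w (dn m) = sum w ({q\<in>S1. q \<le> x} \<union> dn m)"
    proof (rule sum.union_disjoint[symmetric])
      show "{q\<in>S1. q \<le> x} \<inter> dn m = {}" using m(1) unfolding S1_def L_def by blast
    qed (use f1 fin in auto)
    also have "\<dots> \<le> sum w (dn x)"
      using m(2) S1S fin by (intro sum_mono2) (auto simp: dn_def)
    also have "\<dots> < 2 ^ Suc k" using Suc.prems(4)[of x] x S1S unfolding dn_def by blast
    finally show ?thesis using m(1) unfolding M_def H_def by simp
  qed
  \<comment> \<open>An element strictly below a minimal heavy one is not heavy.\<close>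
  have b2: "sum w {q\<in>S2. q \<le> x} < 2 ^ k" if x: "x \<in> S2" for x
  proof -
    have "x \<notin> H" using x unfolding S2_def L_def M_def dn_def by blast
    moreover have "sum w {q\<in>S2. q \<le> x} \<le> sum w (dn x)"
      using S2S fin by (intro sum_mono2) (auto simp: dn_def)
    ultimately show ?thesis using light[of x] x S2S by force
  qed
  have IH: "\<exists>D U. (\<forall>x\<in>T. D x \<subseteq> {q\<in>T. q \<le> x} \<and> U x \<subseteq> {q\<in>T. x \<le> q}) \<and>
      (\<forall>q\<in>T. \<forall>r\<in>T. q \<le> r \<longrightarrow> (\<exists>x\<in>T. q \<in> D x \<and> r \<in> U x)) \<and>
      (\<Sum>x\<in>T. sum w (D x) + sum w (U x)) \<le> 2 * k * sum w T"
    if T: "T \<subseteq> S" "\<forall>x\<in>T. sum w {q\<in>T. q \<le> x} < 2 ^ k" for T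
  proof (rule Suc.IH)
    show "finite T" using T(1) Suc.prems(1) finite_subset by blast
    show "x \<le> y \<or> y \<le> x" if "q \<in> T" "x \<in> T" "y \<in> T" "q \<le> x" "q \<le> y" for q x y
      using Suc.prems(2)[of q x y] that T(1) by blast
    show "0 < w x" if "x \<in> T" for x using Suc.prems(3) that T(1) by blast
  qed (use T in auto)
  have "\<forall>x\<in>S1. sum w {q\<in>S1. q \<le> x} < 2 ^ k" using b1 by blast
  from IH[OF S1S this] obtain D1 U1 where H1: "\<forall>x\<in>S1. D1 x \<subseteq> {q\<in>S1. q \<le> x} \<and> U1 x \<subseteq> {q\<in>S1. x \<le> q}"
    "\<forall>q\<in>S1. \<forall>r\<in>S1. q \<le> r \<longrightarrow> (\<exists>x\<in>S1. q \<in> D1 x \<and> r \<in> U1 x)"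
    "(\<Sum>x\<in>S1. sum w (D1 x) + sum w (U1 x)) \<le> 2 * k * sum w S1"
    by (elim exE conjE) (rule that)
  note 1 = H1(1)[rule_format] H1(2)[rule_format] H1(3)
  have "\<forall>x\<in>S2. sum w {q\<in>S2. q \<le> x} < 2 ^ k" using b2 by blast
  from IH[OF S2S this] obtain D2 U2 where H2: "\<forall>x\<in>S2. D2 x \<subseteq> {q\<in>S2. q \<le> x} \<and> U2 x \<subseteq> {q\<in>S2. x \<le> q}"
    "\<forall>q\<in>S2. \<forall>r\<in>S2. q \<le> r \<longrightarrow> (\<exists>x\<in>S2. q \<in> D2 x \<and> r \<in> U2 x)"
    "(\<Sum>x\<in>S2. sum w (D2 x) + sum w (U2 x)) \<le> 2 * k * sum w S2"
    by (elim exE conjE) (rule that)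
  note 2 = H2(1)[rule_format] H2(2)[rule_format] H2(3)
  define D where "D = (\<lambda>x. if x \<in> M then dn x else if x \<in> S1 then D1 x else D2 x)"
  define U where "U = (\<lambda>x. if x \<in> M then up x else if x \<in> S1 then U1 x else U2 x)"
  have S_eq: "S = M \<union> (S1 \<union> S2)" using LS M_L unfolding S1_def S2_def by blast
  have disj: "M \<inter> (S1 \<union> S2) = {}" "S1 \<inter> S2 = {}" using M_L unfolding S1_def S2_def by blast+
  have D1: "D x = D1 x" "U x = U1 x" if "x \<in> S1" for x
    using that disj unfolding D_def U_def by auto
  have D2: "D x = D2 x" "U x = U2 x" if "x \<in> S2" for x
    using that disj unfolding D_def U_def by auto
  have sub: "D x \<subseteq> dn x \<and> U x \<subseteq> up x" if "x \<in> S" for x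
    using that 1(1)[of x] 2(1)[of x] S1S S2S S_eq D1[of x] D2[of x]
    unfolding D_def U_def dn_def up_def by auto
  have cov: "\<exists>x\<in>S. q \<in> D x \<and> r \<in> U x" if qr: "q \<in> S" "r \<in> S" "q \<le> r" for q r
  proof (cases "q \<in> S1 \<and> r \<in> S1 \<or> q \<in> S2 \<and> r \<in> S2")
    case True
    then show ?thesis using 1(2)[of q r] 2(2)[of q r] qr(3) D1 D2 S1S S2S by (metis in_mono)
  next
    case False
    \<comment> \<open>Since \<open>L\<close> is closed downwards, the only remaining possibility is
      that \<open>q\<close> is in \<open>L\<close> and \<open>r\<close> is not. The member of
      \<open>M\<close> above \<open>q\<close> is comparable with \<open>r\<close> and cannot be
      above it, so it separates the pair.\<close>
    have "\<exists>m\<in>M. q \<le> m \<and> m \<le> r"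
    proof (cases "q \<in> M \<or> r \<in> M")
      case True
      then show ?thesis using qr by blast
    next
      case nM: False
      then have "q \<in> L"
        using False qr S_eq unfolding S1_def S2_def L_def dn_def by (auto intro: order_trans)
      then obtain m where m: "m \<in> M" "q \<le> m" unfolding L_def dn_def by blast
      have "r \<notin> L" using nM False qr \<open>q \<in> L\<close> unfolding S2_def by blast
      then have "\<not> r \<le> m" using m qr unfolding L_def dn_def by blast
      then show ?thesis using Suc.prems(2)[OF qr(1) _ qr(2) m(2) qr(3)] m MS by blast
    qed
    then show ?thesis using qr MS unfolding D_def U_def dn_def up_def by auto
  qed
  \<comment> \<open>The down-sets of the members of \<open>M\<close> are pairwise disjoint, and so
    are the up-sets; each of the two families therefore weighs at most
    \<open>sum w S\<close>.\<close>
  have "(\<Sum>x\<in>M. sum w (D x) + sum w (U x)) = (\<Sum>x\<in>M. sum w (dn x)) + (\<Sum>x\<in>M. sum w (up x))"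
    unfolding D_def U_def by (simp add: sum.distrib)
  also have "(\<Sum>x\<in>M. sum w (dn x)) = sum w (\<Union>x\<in>M. dn x)"
    using finM fin dn_disj by (intro sum.UNION_disjoint[symmetric]) auto
  also have "(\<Sum>x\<in>M. sum w (up x)) = sum w (\<Union>x\<in>M. up x)"
    using finM fin up_disj by (intro sum.UNION_disjoint[symmetric]) auto
  also have "sum w (\<Union>x\<in>M. dn x) + sum w (\<Union>x\<in>M. up x) \<le> sum w S + sum w S"
    using Suc.prems(1) by (intro add_mono sum_mono2) (auto simp: dn_def up_def)
  finally have costM: "(\<Sum>x\<in>M. sum w (D x) + sum w (U x)) \<le> 2 * sum w S" by simp
  have "(\<Sum>x\<in>S. sum w (D x) + sum w (U x)) = (\<Sum>x\<in>M. sum w (D x) + sum w (U x)) +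
     ((\<Sum>x\<in>S1. sum w (D x) + sum w (U x)) + (\<Sum>x\<in>S2. sum w (D x) + sum w (U x)))"
    unfolding S_eq using disj finM f1 f2 by (simp add: sum.union_disjoint)
  also have "\<dots> = (\<Sum>x\<in>M. sum w (D x) + sum w (U x)) +
     ((\<Sum>x\<in>S1. sum w (D1 x) + sum w (U1 x)) + (\<Sum>x\<in>S2. sum w (D2 x) + sum w (U2 x)))"
    using D1 D2 by simp
  also have "\<dots> \<le> 2 * sum w S + (2 * k * sum w S1 + 2 * k * sum w S2)"
    using costM 1(3) 2(3) by linarith
  also have "2 * k * sum w S1 + 2 * k * sum w S2 = 2 * k * sum w (S1 \<union> S2)"
    using disj f1 f2 by (simp add: sum.union_disjoint algebra_simps)
  also have "\<dots> \<le> 2 * k * sum w S"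
    using S1S S2S Suc.prems(1) by (intro mult_left_mono sum_mono2) auto
  finally have "(\<Sum>x\<in>S. sum w (D x) + sum w (U x)) \<le> 2 * Suc k * sum w S" by simp
  moreover have "\<forall>x\<in>S. D x \<subseteq> {q\<in>S. q \<le> x} \<and> U x \<subseteq> {q\<in>S. x \<le> q}"
    using sub unfolding dn_def up_def by blast
  ultimately show ?case
    by (intro exI[of _ D] exI[of _ U] conjI ballI impI cov) simp_all
qed

section \<open>From spanned pairs to hop spanners\<close>

text \<open>Replacing every edge of a shortest walk by at most two edges of \<open>E'\<close> at
  most doubles its length. Edges are undirected, so one orientation of each in \<open>T\<close> is
  enough.\<close>

lemma spanned_imp_hop_spanner:
  assumes "spanned (intersection_edges \<F>) n T"
    and "\<And>a b. {a, b} \<in> intersection_edges \<F> \<Longrightarrow> (a, b) \<in> T \<or> (b, a) \<in> T"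
  shows "\<exists>E'. hop_spanner 2 \<F> (intersection_edges \<F>) E' \<and> card E' \<le> n"
proof -
  let ?E = "intersection_edges \<F>"
  obtain E' where E': "E' \<subseteq> ?E" "card E' \<le> n"
    "\<And>a b. (a, b) \<in> T \<Longrightarrow> {a, b} \<in> E' \<or> (\<exists>z. {a, z} \<in> E' \<and> {z, b} \<in> E')"
    using assms(1) unfolding spanned_def by blast
  have step: "{a, b} \<in> E' \<or> (\<exists>z\<in>\<F>. {a, z} \<in> E' \<and> {z, b} \<in> E')" if "{a, b} \<in> ?E" for a b
  proof -
    have "z \<in> \<F>" if "{x, z} \<in> E'" for x z
      using that E'(1) intersection_edges_iff[of x z \<F>] by blast
    then show ?thesis
      using assms(2)[OF that] E'(3)[of a b] E'(3)[of b a]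
      by (auto simp: insert_commute[of b] insert_commute[of _ a])
  qed
  \<comment> \<open>Walks are lists of vertices: this inequality says that the number of edges at
    most doubles, without subtraction on natural numbers.\<close>
  have walks: "\<exists>p'. walk \<F> E' p' \<and> hd p' = hd p \<and> last p' = last p \<and> length p' + 1 \<le> 2 * length p"
    if "walk \<F> ?E p" for p
    using that
  proof (induction p rule: induct_list012)
    case 1
    then show ?case by (simp add: walk_def)
  next
    case (2 x)
    then show ?case by (intro exI[of _ "[x]"]) (simp add: walk_def)
  next
    case (3 x y p)
    from 3(3) have xy: "{x, y} \<in> ?E" "walk \<F> ?E (y # p)" "x \<in> \<F>"
      by (auto simp: walk_def)
    from 3(2)[OF xy(2)] obtain p' where
      p': "walk \<F> E' p'" "hd p' = y" "last p' = last (y # p)" "length p' + 1 \<le> 2 * length (y # p)"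
      by auto
    from step[OF xy(1)] show ?case
    proof (elim disjE bexE)
      assume "{x, y} \<in> E'"
      then show ?thesis
        using p' xy(3) by (intro exI[of _ "x # p'"]) (auto simp: walk_def successively_Cons)
    next
      fix z assume "z \<in> \<F>" "{x, z} \<in> E' \<and> {z, y} \<in> E'"
      then show ?thesis
        using p' xy(3) by (intro exI[of _ "x # z # p'"]) (auto simp: walk_def successively_Cons)
    qed
  qed
  have "hop_dist \<F> E' x y \<le> enat 2 * hop_dist \<F> ?E x y" for x y
  proof (cases "{p. walk \<F> ?E p \<and> hd p = x \<and> last p = y} = {}")
    case True
    have "hop_dist \<F> ?E x y = \<infinity>" unfolding hop_dist_def True by (simp add: top_enat_def)
    then show ?thesis by simp
  next
    case False
    then obtain p0 where "p0 \<in> {p. walk \<F> ?E p \<and> hd p = x \<and> last p = y}" by blast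
    \<comment> \<open>The order on \<open>enat\<close> is a well-order, so the infimum of a nonempty
      set is attained by an actual walk.\<close>
    then have "hop_dist \<F> ?E x y \<in> (\<lambda>p. enat (length p - 1)) ` {p. walk \<F> ?E p \<and> hd p = x \<and> last p = y}"
      unfolding hop_dist_def by (rule wellorder_InfI[OF imageI])
    then obtain p where p: "walk \<F> ?E p" "hd p = x" "last p = y" "hop_dist \<F> ?E x y = enat (length p - 1)"
      by auto
    obtain p' where p': "walk \<F> E' p'" "hd p' = x" "last p' = y" "length p' + 1 \<le> 2 * length p"
      using walks[OF p(1)] p by auto
    have "hop_dist \<F> E' x y \<le> enat (length p' - 1)"
      unfolding hop_dist_def using p' by (intro INF_lower) auto
    also have "\<dots> \<le> enat (2 * (length p - 1))" using p'(4) by simp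
    finally show ?thesis unfolding p(4) by simp
  qed
  then show ?thesis using E' unfolding hop_spanner_def by blast
qed

section \<open>Dyadic cells\<close>

text \<open>The floor makes the cells half-open, so those of one level partition space. Levels are
  integers because boxes may be arbitrarily small.\<close>

definition dyadic_cell :: "int \<Rightarrow> ('d \<Rightarrow> int) \<Rightarrow> (real ^ 'd) set" where
  "dyadic_cell k v = {x. \<forall>i. \<lfloor>x $ i / 2 powi k\<rfloor> = v i}"

text \<open>The level is part of a node so that the product order on nodes is the quadtree order without
  having to recover the level from the cell.\<close>
definition dyadic_nodes :: "int \<Rightarrow> (real ^ 'd) set \<Rightarrow> (int \<times> (real ^ 'd) set) set" where
  "dyadic_nodes k B = (\<lambda>z. (k, dyadic_cell k (\<lambda>i. \<lfloor>z $ i / 2 powi k\<rfloor>))) ` B"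

text \<open>The index at the coarser level is a function of the index at the finer level, namely its
  integer quotient by a power of two.\<close>

lemma dyadic_cell_mono:
  assumes "j \<le> k" "z \<in> dyadic_cell j v" "z \<in> dyadic_cell k u"
  shows "dyadic_cell j v \<subseteq> dyadic_cell k u"
proof
  fix x assume x: "x \<in> dyadic_cell j v"
  have *: "\<lfloor>t / 2 powi k\<rfloor> = \<lfloor>t / 2 powi j\<rfloor> div 2 ^ nat (k - j)" for t :: real
  proof -
    have "(2::real) powi k = 2 powi j * 2 ^ nat (k - j)"
      using assms(1) by (simp add: power_int_add[symmetric] flip: power_int_of_nat)
    then have "t / 2 powi k = t / 2 powi j / real_of_int (2 ^ nat (k - j))" by simp
    then show ?thesis by (metis floor_divide_real_eq_div zero_le_numeral zero_le_power)
  qed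
  show "x \<in> dyadic_cell k u"
    using x assms(2,3) unfolding dyadic_cell_def by (auto simp: *)
qed

text \<open>Fatness speaks of closed cubes, so it is applied to the closed cube around a
  cell.\<close>

lemma dyadic_cell_subset_cube:
  fixes v :: "'d::finite \<Rightarrow> int"
  shows "dyadic_cell k v \<subseteq> axis_cube (\<chi> i. 2 powi k * of_int (v i)) (2 powi k)"
proof
  fix x assume "x \<in> dyadic_cell k v"
  then have f: "\<lfloor>x $ i / 2 powi k\<rfloor> = v i" for i unfolding dyadic_cell_def by blast
  have pos: "(0::real) < 2 powi k" by simp
  have "of_int (v i) \<le> x $ i / 2 powi k \<and> x $ i / 2 powi k \<le> of_int (v i) + 1" for i
    using f[of i] by linarith
  then show "x \<in> axis_cube (\<chi> i. 2 powi k * of_int (v i)) (2 powi k)"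
    using pos unfolding axis_cube_def by (simp add: field_simps)
qed

text \<open>After scaling by the side of a cell, coordinates of two points of \<open>B\<close>
  differ by less than \<open>2\<close>, so their floors differ by at most \<open>2\<close>. This
  leaves five values per coordinate around those of a fixed point.\<close>

lemma dyadic_nodes_card:
  fixes B :: "(real ^ 'd::finite) set"
  assumes "bounded B" "diameter B < 2 * 2 powi k"
  shows "finite (dyadic_nodes k B)" "card (dyadic_nodes k B) \<le> 5 ^ CARD('d)"
proof -
  have "finite (dyadic_nodes k B) \<and> card (dyadic_nodes k B) \<le> 5 ^ CARD('d)"
  proof (cases "B = {}")
    case False
    then obtain y where y: "y \<in> B" by blast
    define f where "f = (\<lambda>i. \<lfloor>y $ i / 2 powi k\<rfloor>)"
    let ?V = "Pi\<^sub>E (UNIV :: 'd set) (\<lambda>i. {f i - 2..f i + 2})"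
    have sub: "dyadic_nodes k B \<subseteq> (\<lambda>v. (k, dyadic_cell k v)) ` ?V"
    proof -
      have "(\<lambda>i. \<lfloor>z $ i / 2 powi k\<rfloor>) \<in> ?V" if z: "z \<in> B" for z
      proof -
        have "\<lfloor>z $ i / 2 powi k\<rfloor> \<in> {f i - 2..f i + 2}" for i
        proof -
          have "\<bar>z $ i - y $ i\<bar> \<le> dist z y"
            using component_le_norm_cart[of "z - y" i] by (simp add: dist_norm)
          also have "\<dots> \<le> diameter B" using assms(1) z y by (rule diameter_bounded_bound)
          finally have "\<bar>z $ i - y $ i\<bar> < 2 * 2 powi k" using assms(2) by linarith
          moreover have "(0::real) < 2 powi k" by simp
          ultimately have "\<bar>z $ i / 2 powi k - y $ i / 2 powi k\<bar> < 2"
            by (simp add: diff_divide_distrib[symmetric] pos_divide_less_eq)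
          then show ?thesis unfolding f_def atLeastAtMost_iff by linarith
        qed
        then show ?thesis by (simp add: PiE_iff)
      qed
      then show ?thesis unfolding dyadic_nodes_def by blast
    qed
    have fin: "finite ?V" by (intro finite_PiE) auto
    have "card (dyadic_nodes k B) \<le> card ?V"
      using surj_card_le[OF fin sub] .
    also have "\<dots> = 5 ^ CARD('d)" by (simp add: card_PiE)
    finally show ?thesis using sub fin finite_surj by blast
  qed (simp add: dyadic_nodes_def)
  then show "finite (dyadic_nodes k B)" "card (dyadic_nodes k B) \<le> 5 ^ CARD('d)" by auto
qed

text \<open>For unbounded boxes fatness holds at every scale, so one cube that contains a point of
  each nonempty box yields \<open>c\<close> points hitting all of them. Each point gives one stabbed
  group, with the whole family on the other side.\<close>

lemma spanned_unbounded:
  fixes \<F> :: "(real ^ 'd::finite) set set"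
  assumes "finite \<F>" "\<And>b. b \<in> \<F> \<Longrightarrow> axis_box b" "fat c \<F>" "card \<F> \<le> 2 ^ k"
  shows "spanned (intersection_edges \<F>) (c * ((2 * (k + 1)) ^ CARD('d) * (2 * card \<F>)))
    {(a, b). {a, b} \<in> intersection_edges \<F> \<and> \<not> bounded b}"
proof -
  \<comment> \<open>The empty set may be a box and offers no point to choose. It has no edges, so
    leaving it out loses nothing.\<close>
  define X where "X = (\<lambda>b. SOME x. x \<in> b) ` (\<F> - {{}})"
  have "finite X" unfolding X_def using assms(1) by blast
  then have "bounded X" by (rule finite_imp_bounded)
  then obtain L where L: "0 < L" "\<And>x. x \<in> X \<Longrightarrow> norm x \<le> L"
    unfolding bounded_pos by blast
  have meets: "b \<inter> axis_cube (\<chi> i. - L) (2 * L) \<noteq> {}" if "b \<in> \<F>" "b \<noteq> {}" for b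
  proof -
    define x where "x = (SOME x. x \<in> b)"
    have x: "x \<in> b" "x \<in> X"
      using that unfolding X_def x_def by (auto simp: some_in_eq)
    have le: "\<bar>x $ i\<bar> \<le> L" for i
      using component_le_norm_cart[of x i] L(2)[OF x(2)] by linarith
    then have "- L \<le> x $ i \<and> x $ i \<le> - L + 2 * L" for i
      using le[of i] by linarith
    then have "x \<in> axis_cube (\<chi> i. - L) (2 * L)" unfolding axis_cube_def by simp
    then show ?thesis using x by blast
  qed
  have "0 < 2 * L" using L(1) by simp
  then obtain P where P: "finite P" "card P \<le> c"
    "\<And>B. B \<in> \<F> \<Longrightarrow> B \<inter> axis_cube (\<chi> i. - L) (2 * L) \<noteq> {} \<Longrightarrow> \<not> bounded B \<Longrightarrow> P \<inter> B \<noteq> {}"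
    using assms(3) unfolding fat_def by meson
  define m where "m = (2 * (k + 1)) ^ CARD('d) * (2 * card \<F>)"
  have "spanned (intersection_edges \<F>) m {(a, b) \<in> \<F> \<times> {b\<in>\<F>. p \<in> b}. {a, b} \<in> intersection_edges \<F>}" for p
  proof -
    have le: "card {b\<in>\<F>. p \<in> b} \<le> card \<F>" using assms(1) by (intro card_mono) auto
    have "spanned (intersection_edges \<F>) ((2 * (k + 1)) ^ CARD('d) * (card \<F> + card {b\<in>\<F>. p \<in> b}))
      {(a, b) \<in> \<F> \<times> {b\<in>\<F>. p \<in> b}. {a, b} \<in> intersection_edges \<F>}"
      using le assms by (intro spanned_stabbed) auto
    moreover have "(2 * (k + 1)) ^ CARD('d) * (card \<F> + card {b\<in>\<F>. p \<in> b}) \<le> m"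
      unfolding m_def using le by (intro mult_left_mono) auto
    ultimately show ?thesis by (rule spanned_mono) auto
  qed
  from spanned_UN[OF P(1) this]
  have "spanned (intersection_edges \<F>) (card P * m)
     (\<Union>p\<in>P. {(a, b) \<in> \<F> \<times> {b\<in>\<F>. p \<in> b}. {a, b} \<in> intersection_edges \<F>})" by simp
  moreover have "card P * m \<le> c * m" using P(2) by simp
  moreover have "{(a, b). {a, b} \<in> intersection_edges \<F> \<and> \<not> bounded b} \<subseteq>
     (\<Union>p\<in>P. {(a, b) \<in> \<F> \<times> {b\<in>\<F>. p \<in> b}. {a, b} \<in> intersection_edges \<F>})"
  proof clarify
    fix a b assume ab: "{a, b} \<in> intersection_edges \<F>" "\<not> bounded b"
    then have "a \<in> \<F>" "b \<in> \<F>" "b \<noteq> {}" unfolding intersection_edges_iff by auto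
    then show "(a, b) \<in> (\<Union>p\<in>P. {(a, b) \<in> \<F> \<times> {b\<in>\<F>. p \<in> b}. {a, b} \<in> intersection_edges \<F>})"
      using P(3)[OF _ meets ab(2)] ab(1) by auto
  qed
  ultimately show ?thesis unfolding m_def by (rule spanned_mono)
qed

text \<open>One-point boxes have diameter \<open>0\<close> and no level of their own; they get one that is at most every
  other level.\<close>
lemma ex_dyadic_level:
  fixes G :: "'a::metric_space set set"
  assumes "finite G"
  obtains lev :: "'a set \<Rightarrow> int" where
    "\<And>b. b \<in> G \<Longrightarrow> diameter b < 2 * 2 powi lev b"
    "\<And>b. b \<in> G \<Longrightarrow> 0 < diameter b \<Longrightarrow> 2 powi lev b \<le> diameter b"
    "\<And>a b. diameter a \<le> diameter b \<Longrightarrow> lev a \<le> lev b"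
proof -
  \<comment> \<open>The inserted \<open>1\<close> keeps \<open>Min\<close> defined if no diameter is
    positive. Raising diameters to at least \<open>e\<close> keeps the logarithm below meaningful
    and changes no positive diameter in \<open>G\<close>.\<close>
  define e where "e = Min (insert 1 (diameter ` {b\<in>G. 0 < diameter b}))"
  have e: "0 < e" "\<And>b. b \<in> G \<Longrightarrow> 0 < diameter b \<Longrightarrow> e \<le> diameter b"
    unfolding e_def using assms by auto
  define lev where "lev = (\<lambda>b :: 'a set. \<lfloor>log 2 (max e (diameter b))\<rfloor>)"
  have *: "2 powi lev b \<le> max e (diameter b)" "max e (diameter b) < 2 * 2 powi lev b" for b
  proof -
    have pos: "0 < max e (diameter b)" using e(1) by simp
    have "2 powi lev b = (2::real) powr real_of_int (lev b)" by (simp add: powr_real_of_int')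
    also have "\<dots> \<le> max e (diameter b)"
      using pos by (subst le_log_iff[symmetric]) (auto simp: lev_def)
    finally show "2 powi lev b \<le> max e (diameter b)" .
    have "max e (diameter b) < 2 powr (real_of_int (lev b) + 1)"
      using pos by (subst log_less_iff[symmetric]) (auto simp: lev_def)
    also have "\<dots> = 2 * 2 powi lev b" by (simp add: powr_add powr_real_of_int')
    finally show "max e (diameter b) < 2 * 2 powi lev b" .
  qed
  show ?thesis
  proof (rule that[of lev])
    fix b assume "b \<in> G"
    show "diameter b < 2 * 2 powi lev b" using *(2)[of b] by linarith
    show "2 powi lev b \<le> diameter b" if "0 < diameter b"
      using *(1)[of b] e(2)[OF \<open>b \<in> G\<close> that] by linarith
  next
    fix a b :: "'a set" assume "diameter a \<le> diameter b"
    then have "log 2 (max e (diameter a)) \<le> log 2 (max e (diameter b))"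
      using e(1) by (intro log_mono) auto
    then show "lev a \<le> lev b" unfolding lev_def by (rule floor_mono)
  qed
qed

section \<open>Spanners for fat boxes\<close>

text \<open>A union bound, which turns the node weights of the forest decomposition into bounds on
  the sizes of groups of boxes.\<close>

lemma card_meeting_le:
  fixes Q :: "'b \<Rightarrow> 'a set"
  assumes "finite G" "finite T"
  shows "card {b\<in>G. T \<inter> Q b \<noteq> {}} \<le> (\<Sum>q\<in>T. card {b\<in>G. q \<in> Q b})"
proof -
  have "{b\<in>G. T \<inter> Q b \<noteq> {}} = (\<Union>q\<in>T. {b\<in>G. q \<in> Q b})" by blast
  then show ?thesis by (simp only: card_UN_le[OF assms(2)])
qed

text \<open>Factors of the budget: \<open>c\<close> hitting points per node,
  \<open>(2 * (k + 1)) ^ CARD('d)\<close> for a stabbed group, \<open>2 * k\<close> for the forest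
  decomposition, and \<open>5 ^ CARD('d)\<close> nodes per box.\<close>

lemma spanned_bounded:
  fixes \<F> :: "(real ^ 'd::finite) set set"
  assumes "finite \<F>" "\<And>b. b \<in> \<F> \<Longrightarrow> axis_box b" "fat c \<F>" "5 ^ CARD('d) * card \<F> < 2 ^ k"
  shows "spanned (intersection_edges \<F>)
      (c * ((2 * (k + 1)) ^ CARD('d) * (2 * k * (5 ^ CARD('d) * card \<F>))))
      {(a, b). {a, b} \<in> intersection_edges \<F> \<and> bounded a \<and> bounded b \<and> diameter a \<le> diameter b}"
proof -
  define E where "E = intersection_edges \<F>"
  define d where "d = CARD('d)"
  define G where "G = {b\<in>\<F>. bounded b}"
  have G: "finite G" "G \<subseteq> \<F>" "card G \<le> card \<F>"
    using assms(1) unfolding G_def by (auto intro: card_mono)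
  obtain lev where lev: "\<And>b. b \<in> G \<Longrightarrow> diameter b < 2 * 2 powi lev b"
    "\<And>b. b \<in> G \<Longrightarrow> 0 < diameter b \<Longrightarrow> 2 powi lev b \<le> diameter b"
    "\<And>a b. diameter a \<le> diameter b \<Longrightarrow> lev a \<le> lev b"
    using ex_dyadic_level[OF G(1)] by metis
  define Q where "Q = (\<lambda>b. dyadic_nodes (lev b) b)"
  have Q: "finite (Q b)" "card (Q b) \<le> 5 ^ d" if "b \<in> G" for b
    using dyadic_nodes_card[of b "lev b"] lev(1)[OF that] that unfolding G_def Q_def d_def by auto
  define S where "S = (\<Union>b\<in>G. Q b)"
  have finS: "finite S" unfolding S_def using G Q by blast
  define w where "w = (\<lambda>q. card {b\<in>G. q \<in> Q b})"
  \<comment> \<open>Double counting of the incidences between boxes and nodes.\<close>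
  have "sum w S = (\<Sum>q\<in>S. \<Sum>b\<in>G. if q \<in> Q b then 1 else 0)"
    unfolding w_def using G(1) by (simp add: card_eq_sum sum.inter_filter[symmetric] del: sum_constant)
  also have "\<dots> = (\<Sum>b\<in>G. \<Sum>q\<in>S. if q \<in> Q b then 1 else 0)" by (rule sum.swap)
  also have "\<dots> \<le> (\<Sum>b\<in>G. 5 ^ d)"
  proof (rule sum_mono)
    fix b assume b: "b \<in> G"
    have "(\<Sum>q\<in>S. if q \<in> Q b then 1 else 0) = card {q\<in>S. q \<in> Q b}"
      using finS by (simp add: card_eq_sum sum.inter_filter[symmetric] del: sum_constant)
    also have "{q\<in>S. q \<in> Q b} = Q b" unfolding S_def using b by blast
    finally show "(\<Sum>q\<in>S. if q \<in> Q b then 1 else 0) \<le> (5::nat) ^ d" using Q(2)[OF b] by simp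
  qed
  also have "\<dots> \<le> 5 ^ d * card \<F>" using G(3) by simp
  finally have wS: "sum w S \<le> 5 ^ d * card \<F>" .
  have cellS: "\<exists>v. x = (fst x, dyadic_cell (fst x) v)" if "x \<in> S" for x
    using that unfolding S_def Q_def dyadic_nodes_def by auto
  have neS: "snd x \<noteq> {}" if "x \<in> S" for x
    using that unfolding S_def Q_def dyadic_nodes_def dyadic_cell_def by auto
  \<comment> \<open>Cells above \<open>q\<close> share a point of the cell of \<open>q\<close>, so
    they are nested in the order of their levels.\<close>
  have forest: "x \<le> y \<or> y \<le> x" if xy: "q \<in> S" "x \<in> S" "y \<in> S" "q \<le> x" "q \<le> y" for q x y
  proof -
    obtain z where "z \<in> snd q" using neS[OF xy(1)] by blast
    then have z: "z \<in> snd x" "z \<in> snd y" using xy(4,5) by (auto simp: less_eq_prod_def)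
    obtain u v where uv: "x = (fst x, dyadic_cell (fst x) u)" "y = (fst y, dyadic_cell (fst y) v)"
      using cellS[OF xy(2)] cellS[OF xy(3)] by blast
    have z': "z \<in> dyadic_cell (fst x) u" "z \<in> dyadic_cell (fst y) v"
      using z uv by (metis snd_conv)+
    show ?thesis
    proof (cases "fst x \<le> fst y")
      case True
      then have "snd x \<subseteq> snd y" using dyadic_cell_mono[OF True z'] uv by (metis snd_conv)
      then show ?thesis using True by (simp add: less_eq_prod_def)
    next
      case False
      then have le: "fst y \<le> fst x" by simp
      then have "snd y \<subseteq> snd x" using dyadic_cell_mono[OF le z'(2,1)] uv by (metis snd_conv)
      then show ?thesis using le by (simp add: less_eq_prod_def)
    qed
  qed
  have wpos: "0 < w x" if "x \<in> S" for x
    using that G(1) unfolding w_def S_def by (auto simp: card_gt_0_iff)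
  have small: "sum w {q\<in>S. q \<le> x} < 2 ^ k" for x
  proof -
    have "sum w {q\<in>S. q \<le> x} \<le> sum w S" using finS by (intro sum_mono2) auto
    then show ?thesis using wS assms(4) unfolding d_def by linarith
  qed
  have "\<exists>D U. (\<forall>x\<in>S. D x \<subseteq> {q\<in>S. q \<le> x} \<and> U x \<subseteq> {q\<in>S. x \<le> q}) \<and>
      (\<forall>q\<in>S. \<forall>r\<in>S. q \<le> r \<longrightarrow> (\<exists>x\<in>S. q \<in> D x \<and> r \<in> U x)) \<and>
      (\<Sum>x\<in>S. sum w (D x) + sum w (U x)) \<le> 2 * k * sum w S"
    by (rule forest_decomposition[OF finS]) ((rule forest; assumption), erule wpos, rule small)
  then obtain D U where DU: "\<forall>x\<in>S. D x \<subseteq> {q\<in>S. q \<le> x} \<and> U x \<subseteq> {q\<in>S. x \<le> q}"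
    "\<forall>q\<in>S. \<forall>r\<in>S. q \<le> r \<longrightarrow> (\<exists>x\<in>S. q \<in> D x \<and> r \<in> U x)"
    "(\<Sum>x\<in>S. sum w (D x) + sum w (U x)) \<le> 2 * k * sum w S"
    by (elim exE conjE) (rule that)
  \<comment> \<open>Fatness for the cube around the cell of \<open>x\<close>, whose side is
    \<open>2 powi fst x\<close>.\<close>
  have "\<exists>P. finite P \<and> card P \<le> c \<and>
      (\<forall>B\<in>\<F>. B \<inter> snd x \<noteq> {} \<and> 2 powi fst x \<le> diameter B \<longrightarrow> P \<inter> B \<noteq> {})" if x: "x \<in> S" for x
  proof -
    obtain v where v: "x = (fst x, dyadic_cell (fst x) v)" using cellS[OF x] by blast
    let ?a = "\<chi> i. 2 powi fst x * real_of_int (v i)"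
    have sub: "snd x \<subseteq> axis_cube ?a (2 powi fst x)"
      using dyadic_cell_subset_cube[of "fst x" v] v by (metis snd_conv)
    have "(0::real) < 2 powi fst x" by simp
    then obtain P where "finite P" "card P \<le> c" "\<forall>B\<in>\<F>. B \<inter> axis_cube ?a (2 powi fst x) \<noteq> {} \<and>
        (\<not> bounded B \<or> 2 powi fst x \<le> diameter B) \<longrightarrow> P \<inter> B \<noteq> {}"
      using assms(3) unfolding fat_def by meson
    then show ?thesis using sub by (intro exI[of _ P]) blast
  qed
  then obtain P where P: "\<And>x. x \<in> S \<Longrightarrow> finite (P x)" "\<And>x. x \<in> S \<Longrightarrow> card (P x) \<le> c"
    "\<And>x B. x \<in> S \<Longrightarrow> B \<in> \<F> \<Longrightarrow> B \<inter> snd x \<noteq> {} \<Longrightarrow> 2 powi fst x \<le> diameter B \<Longrightarrow> P x \<inter> B \<noteq> {}"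
    by metis
  define C where "C = (2 * (k + 1)) ^ d"
  define A where "A = (\<lambda>x. {a\<in>G. D x \<inter> Q a \<noteq> {}})"
  define B where "B = (\<lambda>x p. {b\<in>G. U x \<inter> Q b \<noteq> {} \<and> p \<in> b})"
  have "1 * card \<F> \<le> 5 ^ CARD('d) * card \<F>" by (intro mult_right_mono) auto
  then have n: "card \<F> \<le> 2 ^ k" using assms(4) by linarith
  have group: "spanned E (C * (sum w (D x) + sum w (U x))) {(a, b) \<in> A x \<times> B x p. {a, b} \<in> E}"
    if x: "x \<in> S" for x p
  proof -
    have fin: "finite (D x)" "finite (U x)"
      using DU(1) x finS by (auto intro: finite_subset[of _ S])
    have AB: "A x \<subseteq> \<F>" "B x p \<subseteq> \<F>" using G(2) unfolding A_def B_def by auto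
    have cA: "card (A x) \<le> sum w (D x)"
      unfolding A_def w_def by (rule card_meeting_le[OF G(1) fin(1)])
    have "card (B x p) \<le> card {b\<in>G. U x \<inter> Q b \<noteq> {}}"
      unfolding B_def using G(1) by (intro card_mono) auto
    also have "\<dots> \<le> sum w (U x)"
      unfolding w_def by (rule card_meeting_le[OF G(1) fin(2)])
    finally have cB: "card (B x p) \<le> sum w (U x)" .
    have "card (B x p) \<le> 2 ^ k"
      using card_mono[OF assms(1) AB(2)] n by linarith
    then have "spanned E (C * (card (A x) + card (B x p))) {(a, b) \<in> A x \<times> B x p. {a, b} \<in> E}"
      unfolding E_def C_def d_def using assms(1,2) AB by (intro spanned_stabbed) (auto simp: B_def)
    then show ?thesis
      by (rule spanned_mono) (use cA cB in \<open>auto intro!: mult_left_mono\<close>)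
  qed
  have node: "spanned E (c * (C * (sum w (D x) + sum w (U x))))
     (\<Union>p\<in>P x. {(a, b) \<in> A x \<times> B x p. {a, b} \<in> E})" if x: "x \<in> S" for x
  proof -
    have "spanned E (\<Sum>p\<in>P x. C * (sum w (D x) + sum w (U x)))
      (\<Union>p\<in>P x. {(a, b) \<in> A x \<times> B x p. {a, b} \<in> E})"
      by (intro spanned_UN P(1) group x)
    then show ?thesis
      by (rule spanned_mono) (use P(2)[OF x] in auto)
  qed
  have all: "spanned E (\<Sum>x\<in>S. c * (C * (sum w (D x) + sum w (U x))))
      (\<Union>x\<in>S. \<Union>p\<in>P x. {(a, b) \<in> A x \<times> B x p. {a, b} \<in> E})"
    by (intro spanned_UN finS node)
  have "(\<Sum>x\<in>S. c * (C * (sum w (D x) + sum w (U x)))) =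
      c * (C * (\<Sum>x\<in>S. sum w (D x) + sum w (U x)))"
    by (simp add: sum_distrib_left)
  also have "\<dots> \<le> c * (C * (2 * k * (5 ^ d * card \<F>)))"
    using order_trans[OF DU(3) mult_left_mono[OF wS]] by (intro mult_left_mono) auto
  finally have cost: "(\<Sum>x\<in>S. c * (C * (sum w (D x) + sum w (U x)))) \<le> c * (C * (2 * k * (5 ^ d * card \<F>)))" .
  have "{(a, b). {a, b} \<in> E \<and> bounded a \<and> bounded b \<and> diameter a \<le> diameter b} \<subseteq>
      (\<Union>x\<in>S. \<Union>p\<in>P x. {(a, b) \<in> A x \<times> B x p. {a, b} \<in> E})"
  proof clarify
    fix a b assume e: "{a, b} \<in> E" and bd: "bounded a" "bounded b" and dm: "diameter a \<le> diameter b"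
    have ab: "a \<in> G" "b \<in> G" "a \<noteq> b"
      using e bd unfolding E_def G_def intersection_edges_iff by auto
    obtain z where z: "z \<in> a" "z \<in> b" using e unfolding E_def intersection_edges_iff by blast
    \<comment> \<open>Two intersecting boxes of diameter \<open>0\<close> are the same single point,
      contrary to \<open>a \<noteq> b\<close>. Positivity is what allows the level of
      \<open>b\<close> to be compared with its diameter.\<close>
    have dpos: "0 < diameter b"
    proof (rule ccontr)
      assume "\<not> 0 < diameter b"
      then have 0: "diameter a \<le> 0" "diameter b \<le> 0" using dm by auto
      have "x = z" if "x \<in> a" for x
        using diameter_bounded_bound[OF bd(1) that z(1)] 0(1) by (metis dist_le_zero_iff order_trans)
      moreover have "x = z" if "x \<in> b" for x
        using diameter_bounded_bound[OF bd(2) that z(2)] 0(2) by (metis dist_le_zero_iff order_trans)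
      ultimately show False using ab(3) z by blast
    qed
    \<comment> \<open>The cells around one common point \<open>z\<close> form a chain that passes
      through a node of \<open>a\<close> and a node of \<open>b\<close>.\<close>
    define node where "node = (\<lambda>k. (k, dyadic_cell k (\<lambda>i. \<lfloor>z $ i / 2 powi k\<rfloor>)))"
    have in_node: "z \<in> snd (node j)" for j unfolding node_def dyadic_cell_def by simp
    have nQ: "node (lev a) \<in> Q a" "node (lev b) \<in> Q b"
      using z unfolding Q_def dyadic_nodes_def node_def by auto
    then have nS: "node (lev a) \<in> S" "node (lev b) \<in> S" using ab unfolding S_def by auto
    have "node (lev a) \<le> node (lev b)"
      using lev(3)[OF dm] dyadic_cell_mono[OF lev(3)[OF dm]] in_node[of "lev a"] in_node[of "lev b"]
      unfolding node_def by (simp add: less_eq_prod_def)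
    then obtain x where x: "x \<in> S" "node (lev a) \<in> D x" "node (lev b) \<in> U x"
      using DU(2) nS by blast
    then have le: "node (lev a) \<le> x" "x \<le> node (lev b)" using DU(1) by auto
    \<comment> \<open>The separating node \<open>x\<close> lies between the two: from below it
      inherits the point \<open>z\<close> of \<open>b\<close>, and from above a side of at most the
      diameter of \<open>b\<close>. Hence \<open>P x\<close> hits \<open>b\<close>.\<close>
    have "z \<in> snd x" using le(1) in_node[of "lev a"] by (auto simp: less_eq_prod_def)
    moreover have "fst x \<le> lev b" using le(2) by (simp add: less_eq_prod_def node_def)
    then have "(2::real) powi fst x \<le> 2 powi lev b" by (intro power_int_increasing) auto
    then have "2 powi fst x \<le> diameter b" using lev(2)[OF ab(2) dpos] by linarith
    ultimately have "P x \<inter> b \<noteq> {}" using P(3)[OF x(1), of b] G(2) ab(2) z by blast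
    then obtain p where p: "p \<in> P x" "p \<in> b" by blast
    have "a \<in> A x" "b \<in> B x p" using ab nQ x p unfolding A_def B_def by auto
    then show "(a, b) \<in> (\<Union>x\<in>S. \<Union>p\<in>P x. {(a, b) \<in> A x \<times> B x p. {a, b} \<in> E})"
      using x(1) p(1) e by blast
  qed
  then show ?thesis using spanned_mono[OF all cost] unfolding E_def C_def d_def by blast
qed

text \<open>Each edge is covered in a suitable orientation: an unbounded box is put second if there
  is one, and otherwise a box of larger or equal diameter.\<close>

lemma box_spanner:
  fixes \<F> :: "(real ^ 'd::finite) set set"
  assumes "finite \<F>" "\<And>b. b \<in> \<F> \<Longrightarrow> axis_box b" "fat c \<F>" "5 ^ CARD('d) * card \<F> < 2 ^ k"
  shows "\<exists>E'. hop_spanner 2 \<F> (intersection_edges \<F>) E' \<and>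
    card E' \<le> c * 2 ^ (CARD('d) + 1) * 5 ^ CARD('d) * (k + 1) ^ (CARD('d) + 1) * card \<F>"
proof -
  let ?E = "intersection_edges \<F>"
  have "1 * card \<F> \<le> 5 ^ CARD('d) * card \<F>" by (intro mult_right_mono) auto
  then have n: "card \<F> \<le> 2 ^ k" using assms(4) by linarith
  have "spanned ?E
     (c * ((2 * (k + 1)) ^ CARD('d) * (2 * card \<F>)) +
      c * ((2 * (k + 1)) ^ CARD('d) * (2 * k * (5 ^ CARD('d) * card \<F>))))
     ({(a, b). {a, b} \<in> ?E \<and> \<not> bounded b} \<union>
      {(a, b). {a, b} \<in> ?E \<and> bounded a \<and> bounded b \<and> diameter a \<le> diameter b})"
    using assms n by (intro spanned_Un spanned_unbounded spanned_bounded)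
  then have "\<exists>E'. hop_spanner 2 \<F> ?E E' \<and> card E' \<le> 
      c * ((2 * (k + 1)) ^ CARD('d) * (2 * card \<F>)) +
      c * ((2 * (k + 1)) ^ CARD('d) * (2 * k * (5 ^ CARD('d) * card \<F>)))"
    by (rule spanned_imp_hop_spanner) (auto simp: insert_commute)
  moreover have "c * ((2 * (k + 1)) ^ CARD('d) * (2 * card \<F>)) +
      c * ((2 * (k + 1)) ^ CARD('d) * (2 * k * (5 ^ CARD('d) * card \<F>)))
      \<le> c * 2 ^ (CARD('d) + 1) * 5 ^ CARD('d) * (k + 1) ^ (CARD('d) + 1) * card \<F>"
  proof -
    have "card \<F> + k * (5 ^ CARD('d) * card \<F>) \<le> (k + 1) * (5 ^ CARD('d) * card \<F>)"
      using \<open>1 * card \<F> \<le> 5 ^ CARD('d) * card \<F>\<close> by simp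
    then have "c * ((2 * (k + 1)) ^ CARD('d) * 2) * (card \<F> + k * (5 ^ CARD('d) * card \<F>))
      \<le> c * ((2 * (k + 1)) ^ CARD('d) * 2) * ((k + 1) * (5 ^ CARD('d) * card \<F>))"
      by (intro mult_left_mono) auto
    moreover have "(2 * (k + 1)) ^ CARD('d) = 2 ^ CARD('d) * (k + 1) ^ CARD('d)"
      by (rule power_mult_distrib)
    ultimately show ?thesis by (simp add: algebra_simps)
  qed
  ultimately show ?thesis by (meson order_trans)
qed

section \<open>Cubes are fat\<close>

lemma axis_box_axis_cube: "axis_box (axis_cube a l)"
  unfolding axis_box_def axis_cube_def
  by (intro exI[of _ "\<lambda>i. {a $ i..a $ i + l}"]) (auto simp: is_interval_cc)

text \<open>The bound through the l1 norm is cruder than the one with a square root, but its factor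
  is an integer, which suits the grid used for fatness.\<close>

lemma diameter_axis_cube_le:
  fixes a :: "real ^ 'd::finite"
  assumes "0 \<le> s"
  shows "bounded (axis_cube a s)" "diameter (axis_cube a s) \<le> real CARD('d) * s"
proof -
  have le: "dist x y \<le> real CARD('d) * s" if "x \<in> axis_cube a s" "y \<in> axis_cube a s" for x y
  proof -
    have *: "\<bar>(x - y) $ i\<bar> \<le> s" for i
    proof -
      have "a $ i \<le> x $ i" "x $ i \<le> a $ i + s" "a $ i \<le> y $ i" "y $ i \<le> a $ i + s"
        using that unfolding axis_cube_def by auto
      then show ?thesis by simp
    qed
    have "norm (x - y) \<le> (\<Sum>i\<in>UNIV. \<bar>(x - y) $ i\<bar>)" by (rule norm_le_l1_cart)
    also have "\<dots> \<le> (\<Sum>i\<in>(UNIV::'d set). s)" by (intro sum_mono *)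
    finally show ?thesis by (simp add: dist_norm)
  qed
  have "a \<in> axis_cube a s" using assms unfolding axis_cube_def by simp
  then show "bounded (axis_cube a s)" unfolding bounded_def using le by blast
  show "diameter (axis_cube a s) \<le> real CARD('d) * s"
    using assms le by (intro diameter_le) (auto simp: dist_norm)
qed

text \<open>If the interval starts at or before the grid, it contains \<open>a\<close>; otherwise it
  contains the first grid point not below \<open>b\<close>, as its length is at least the step
  \<open>h\<close>.\<close>

lemma grid_point_in_interval:
  fixes a b s h t :: real
  assumes "0 < h" "h \<le> s" "b \<le> t" "t \<le> b + s" "a \<le> t" "t \<le> a + real m * h"
  shows "\<exists>j\<in>{..m}. b \<le> a + real j * h \<and> a + real j * h \<le> b + s"
proof (cases "b \<le> a")
  case True
  then show ?thesis using assms by (intro bexI[of _ 0]) auto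
next
  case False
  define j where "j = nat \<lceil>(b - a) / h\<rceil>"
  have j: "real j = of_int \<lceil>(b - a) / h\<rceil>"
    unfolding j_def using False assms(1) by (simp add: ceiling_le_iff)
  have "(b - a) / h \<le> real j" "real j < (b - a) / h + 1"
    unfolding j by linarith+
  then have 1: "b \<le> a + real j * h" "a + real j * h < b + h"
    using assms(1) by (simp_all add: field_simps)
  have "(b - a) / h \<le> real m" using assms by (simp add: field_simps)
  then have "j \<le> m" unfolding j_def by (simp add: ceiling_le_iff)
  then show ?thesis using 1 assms(2) by (intro bexI[of _ j]) auto
qed

text \<open>A cube of diameter at least \<open>l\<close> has side at least
  \<open>l / CARD('d)\<close>. A grid with this spacing on the given cube, with
  \<open>CARD('d) + 1\<close> points per axis, therefore hits it.\<close>

lemma fat_axis_cubes: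
  fixes \<F> :: "(real ^ 'd::finite) set set"
  assumes "\<And>B. B \<in> \<F> \<Longrightarrow> \<exists>a l. 0 < l \<and> B = axis_cube a l"
  shows "fat ((CARD('d) + 1) ^ CARD('d)) \<F>"
  unfolding fat_def
proof (intro allI impI)
  fix a :: "real ^ 'd" and l :: real assume l: "0 < l"
  let ?d = "CARD('d)"
  define h where "h = l / real ?d"
  have h: "0 < h" "real ?d * h = l" using l unfolding h_def by auto
  let ?V = "Pi\<^sub>E (UNIV :: 'd set) (\<lambda>i. {..?d})"
  define P where "P = (\<lambda>v. \<chi> i. a $ i + real (v i) * h) ` ?V"
  have fin: "finite ?V" by (intro finite_PiE) auto
  have "card P \<le> card ?V" unfolding P_def using fin by (rule card_image_le)
  also have "\<dots> = (?d + 1) ^ ?d" by (simp add: card_PiE)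
  finally have "card P \<le> (?d + 1) ^ ?d" .
  moreover have "P \<inter> B \<noteq> {}" if B: "B \<in> \<F>" "B \<inter> axis_cube a l \<noteq> {}"
    and big: "\<not> bounded B \<or> l \<le> diameter B" for B
  proof -
    obtain b s where bs: "0 < s" "B = axis_cube b s" using assms[OF B(1)] by blast
    have "l \<le> real ?d * s"
      using diameter_axis_cube_le[of s b] big bs by auto
    then have hs: "h \<le> s" unfolding h_def by (simp add: field_simps)
    obtain t where "t \<in> B" "t \<in> axis_cube a l" using B(2) by blast
    then have t: "b $ i \<le> t $ i" "t $ i \<le> b $ i + s" "a $ i \<le> t $ i" "t $ i \<le> a $ i + real ?d * h" for i
      unfolding bs axis_cube_def h(2) by auto
    have "\<exists>j\<in>{..?d}. b $ i \<le> a $ i + real j * h \<and> a $ i + real j * h \<le> b $ i + s" for i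
      by (rule grid_point_in_interval[OF h(1) hs t])
    then obtain v where v: "\<And>i. v i \<in> {..?d}"
      "\<And>i. b $ i \<le> a $ i + real (v i) * h \<and> a $ i + real (v i) * h \<le> b $ i + s" by metis
    have "(\<chi> i. a $ i + real (v i) * h) \<in> P" unfolding P_def using v(1) by (auto simp: PiE_iff)
    moreover have "(\<chi> i. a $ i + real (v i) * h) \<in> B" unfolding bs axis_cube_def using v(2) by simp
    ultimately show ?thesis by blast
  qed
  ultimately show "\<exists>P. finite P \<and> card P \<le> (?d + 1) ^ ?d \<and>
      (\<forall>B\<in>\<F>. B \<inter> axis_cube a l \<noteq> {} \<and> (\<not> bounded B \<or> l \<le> diameter B) \<longrightarrow> P \<inter> B \<noteq> {})"
    using fin unfolding P_def by blast
qed

section \<open>The asymptotic bound\<close>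

lemma ceiling_log_bigo:
  "(\<lambda>n. real n * real (m + nat \<lceil>log 2 (real n)\<rceil>) ^ e) \<in> O(\<lambda>n. real n * ln (real n) ^ e)"
proof -
  have "(\<lambda>n. real (m + nat \<lceil>log 2 (real n)\<rceil>)) \<in> O(\<lambda>n. real m + 1 + log 2 (real n))"
  proof (rule bigoI[of _ 1])
    show "\<forall>\<^sub>F n in sequentially. norm (real (m + nat \<lceil>log 2 (real n)\<rceil>)) \<le> 1 * norm (real m + 1 + log 2 (real n))"
      \<comment> \<open>From \<open>n = 1\<close> on the logarithm is nonnegative, so
        \<open>nat\<close> truncates nothing.\<close>
      using eventually_ge_at_top[of 1]
    proof eventually_elim
      case (elim n)
      then have "0 \<le> log 2 (real n)" by simp
      moreover have "real (nat \<lceil>log 2 (real n)\<rceil>) \<le> log 2 (real n) + 1"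
        using of_int_ceiling_le_add_one[of "log 2 (real n)"] calculation by linarith
      ultimately show ?case by (simp del: of_int_ceiling_le_add_one)
    qed
  qed
  also have "(\<lambda>n::nat. real m + 1 + log 2 (real n)) \<in> O(\<lambda>n. ln (real n))"
    by real_asymp
  finally show ?thesis
    by (intro landau_o.big.mult landau_o.big_power) auto
qed

theorem theorem3p10:
  assumes "CARD('d::finite) \<ge> 2"
  shows "(\<forall>c. \<exists>f :: nat \<Rightarrow> real.
            f \<in> O(\<lambda>n. real n * ln (real n) ^ (CARD('d) + 1)) \<and>
            (\<forall>n. \<forall>\<B> :: (real ^ 'd) set set.
               finite \<B> \<and> card \<B> = n \<and> (\<forall>B\<in>\<B>. axis_box B) \<and> fat c \<B> \<longrightarrow>
               (\<exists>E'. hop_spanner 2 \<B> (intersection_edges \<B>) E' \<and> real (card E') \<le> f n)))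
       \<and> (\<exists>c. \<forall>\<B> :: (real ^ 'd) set set.
            (\<forall>B\<in>\<B>. \<exists>a l. 0 < l \<and> B = axis_cube a l) \<longrightarrow>
            (\<forall>B\<in>\<B>. axis_box B) \<and> fat c \<B>)"
proof (intro conjI allI)
  fix c :: nat
  let ?d = "CARD('d)"
  \<comment> \<open>The summand \<open>3 * ?d\<close> absorbs \<open>5 ^ ?d\<close>, which is at
    most \<open>8 ^ ?d\<close>; the extra \<open>1\<close> makes the inequality
    \<open>5 ^ ?d * n < 2 ^ k n\<close> strict.\<close>
  define k where "k = (\<lambda>n. 3 * ?d + 1 + nat \<lceil>log 2 (real n)\<rceil>)"
  define C where "C = c * 2 ^ (?d + 1) * 5 ^ ?d"
  define f where "f = (\<lambda>n. real C * (real n * real (k n + 1) ^ (?d + 1)))"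
  have k_eq: "k n + 1 = 3 * ?d + 2 + nat \<lceil>log 2 (real n)\<rceil>" for n unfolding k_def by simp
  have big: "f \<in> O(\<lambda>n. real n * ln (real n) ^ (?d + 1))"
    unfolding f_def k_eq using ceiling_log_bigo[of "3 * ?d + 2" "?d + 1"] by (cases "C = 0") simp_all
  have size: "5 ^ ?d * n < 2 ^ k n" for n :: nat
  proof -
    have "real n \<le> 2 ^ nat \<lceil>log 2 (real n)\<rceil>"
    proof (cases "n = 0")
      case False
      have "real n = 2 powr log 2 (real n)" using False by simp
      also have "\<dots> \<le> 2 powr real (nat \<lceil>log 2 (real n)\<rceil>)" by (intro powr_mono) linarith+
      finally show ?thesis by (simp add: powr_realpow)
    qed simp
    then have n: "n \<le> 2 ^ nat \<lceil>log 2 (real n)\<rceil>" by (simp flip: of_nat_le_iff)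
    have "(5::nat) ^ ?d \<le> 8 ^ ?d" by (intro power_mono) auto
    also have "\<dots> = 2 ^ (3 * ?d)" by (simp add: power_mult)
    finally have "5 ^ ?d * n \<le> 2 ^ (3 * ?d) * 2 ^ nat \<lceil>log 2 (real n)\<rceil>"
      using n by (intro mult_mono) auto
    also have "\<dots> < 2 ^ k n" unfolding k_def by (simp add: power_add)
    finally show ?thesis .
  qed
  have "\<exists>E'. hop_spanner 2 \<B> (intersection_edges \<B>) E' \<and> real (card E') \<le> f n"
    if B: "finite \<B> \<and> card \<B> = n \<and> (\<forall>B\<in>\<B>. axis_box B) \<and> fat c \<B>"
    for n and \<B> :: "(real ^ 'd) set set"
  proof -
    obtain E' where E': "hop_spanner 2 \<B> (intersection_edges \<B>) E'"
      "card E' \<le> C * (k n + 1) ^ (?d + 1) * n"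
      using box_spanner[of \<B> c "k n"] B size[of n] unfolding C_def by auto
    have "real (card E') \<le> real (C * (k n + 1) ^ (?d + 1) * n)"
      using E'(2) by (rule of_nat_mono)
    also have "\<dots> = f n" unfolding f_def by (simp add: algebra_simps)
    finally show ?thesis using E'(1) by blast
  qed
  with big show "\<exists>f :: nat \<Rightarrow> real.
            f \<in> O(\<lambda>n. real n * ln (real n) ^ (?d + 1)) \<and>
            (\<forall>n. \<forall>\<B> :: (real ^ 'd) set set.
               finite \<B> \<and> card \<B> = n \<and> (\<forall>B\<in>\<B>. axis_box B) \<and> fat c \<B> \<longrightarrow>
               (\<exists>E'. hop_spanner 2 \<B> (intersection_edges \<B>) E' \<and> real (card E') \<le> f n))"
    by blast
next
  show "\<exists>c. \<forall>\<B> :: (real ^ 'd) set set.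
            (\<forall>B\<in>\<B>. \<exists>a l. 0 < l \<and> B = axis_cube a l) \<longrightarrow>
            (\<forall>B\<in>\<B>. axis_box B) \<and> fat c \<B>"
  proof (intro exI[of _ "(CARD('d) + 1) ^ CARD('d)"] allI impI)
    fix \<B> :: "(real ^ 'd) set set"
    assume *: "\<forall>B\<in>\<B>. \<exists>a l. 0 < l \<and> B = axis_cube a l"
    have "axis_box B" if "B \<in> \<B>" for B
      using bspec[OF * that] axis_box_axis_cube by blast
    moreover have "fat ((CARD('d) + 1) ^ CARD('d)) \<B>"
      by (rule fat_axis_cubes) (rule bspec[OF *])
    ultimately show "(\<forall>B\<in>\<B>. axis_box B) \<and> fat ((CARD('d) + 1) ^ CARD('d)) \<B>" by blast
  qed
qed

end
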